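(* Let $(X,T)$ be a topological dynamical system. Then $S_{me}(X,T)$ is the smallest closed $T\times T$-invariant equivalence relation on $X$ containing $Q_{me}(X,T)$.
   Context: A topological dynamical system is a pair $(X,T)$ where $X$ is a non-empty compact metric space with metric $d$ and $T\colon X\to X$ is a continuous map. $(X,T)$ is mean equicontinuous if for every $\varepsilon>0$ there exists $\delta>0$ such that whenever $x,y\in X$ with $d(x,y)<\delta$, we have $\limsup_{n\to\infty}\frac1n\sum_{i=0}^{n-1}d(T^ix,T^iy)<\varepsilon$. An equivalence relation $R\subset X\times X$ is closed if it is a closed subset of $X\times X$, and $T\times T$-invariant if $(x,y)\in R$ implies $(Tx,Ty)\in R$. For such $R$, $X/R$ is a compact metrizable space and $T$ induces a continuous map on $X/R$ by $[x]\mapsto[Tx]$; $X/R$ is regarded as a dynamical system with this map. $S_{me}(X,T)$ denotes the smallest closed $T\times T$-invariant equivalence relation on $X$ such that the quotient system $X/S_{me}(X,T)$ is mean equicontinuous (it is known that every system admits a maximal mean equicontinuous factor, so this relation exists). A pair $(x,y)\in X\times X$ is sensitive in the mean if $x=y$ or the following holds: for any $\tau>0$ there exists $c=c(\tau)>0$ such that for every $\epsilon>0$ there exist $x',y'\in X$ and an integer $n\ge1$ such that $d(x',y')<\epsilon$ and $$\frac1n\#\{0\le i\le n-1: d(T^ix',x)<\tau,\ d(T^iy',y)<\tau\}>c.$$ $Q_{me}(X,T)$ denotes the set of all pairs sensitive in the mean in $(X,T)$. *)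

theory Defs
  imports "HOL-Analysis.Analysis"
begin

definition dynamical_system :: "'a set \<Rightarrow> ('a \<Rightarrow> 'a \<Rightarrow> real) \<Rightarrow> ('a \<Rightarrow> 'a) \<Rightarrow> bool" where
  "dynamical_system X d T \<longleftrightarrow>
     Metric_space X d \<and> X \<noteq> {} \<and>
     compact_space (Metric_space.mtopology X d) \<and>
     continuous_map (Metric_space.mtopology X d) (Metric_space.mtopology X d) T"

definition mean_equicontinuous :: "'a set \<Rightarrow> ('a \<Rightarrow> 'a \<Rightarrow> real) \<Rightarrow> ('a \<Rightarrow> 'a) \<Rightarrow> bool" where
  "mean_equicontinuous X d T \<longleftrightarrow>
     (\<forall>\<epsilon>>0. \<exists>\<delta>>0. \<forall>x\<in>X. \<forall>y\<in>X. d x y < \<delta> \<longrightarrow>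
        limsup (\<lambda>n. ereal ((1 / real n) * (\<Sum>i<n. d ((T ^^ i) x) ((T ^^ i) y)))) < ereal \<epsilon>)"

definition closed_invariant_equiv ::
    "'a set \<Rightarrow> ('a \<Rightarrow> 'a \<Rightarrow> real) \<Rightarrow> ('a \<Rightarrow> 'a) \<Rightarrow> 'a rel \<Rightarrow> bool" where
  "closed_invariant_equiv X d T R \<longleftrightarrow>
     equiv X R \<and>
     closedin (prod_topology (Metric_space.mtopology X d) (Metric_space.mtopology X d)) R \<and>
     (\<forall>x y. (x, y) \<in> R \<longrightarrow> (T x, T y) \<in> R)"

text \<open>When \<open>R\<close> is an invariant equivalence relation and \<open>C\<close> is the class of \<open>x\<close>, the
  image \<open>T ` C\<close> lies in the class of \<open>T x\<close>, so this map sends the class of \<open>x\<close> to that of \<open>T x\<close>.\<close>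

definition quotient_dyn :: "('a \<Rightarrow> 'a) \<Rightarrow> 'a rel \<Rightarrow> 'a set \<Rightarrow> 'a set" where
  "quotient_dyn T R C = R `` (T ` C)"

text \<open>The quotient \<open>X // R\<close> carries no distinguished metric. It is measured by a metric \<open>d'\<close>
  inducing the quotient topology, which is what \<open>quotient_map\<close> says about the projection. On
  a compact metrizable space, mean equicontinuity does not depend on the choice of
  compatible metric.\<close>

definition mean_equicontinuous_quotient ::
    "'a set \<Rightarrow> ('a \<Rightarrow> 'a \<Rightarrow> real) \<Rightarrow> ('a \<Rightarrow> 'a) \<Rightarrow> 'a rel \<Rightarrow> bool" where
  "mean_equicontinuous_quotient X d T R \<longleftrightarrow>
     (\<exists>d'. Metric_space (X // R) d' \<and>
        quotient_map (Metric_space.mtopology X d) (Metric_space.mtopology (X // R) d')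
          (\<lambda>x. R `` {x}) \<and>
        mean_equicontinuous (X // R) d' (quotient_dyn T R))"

definition S_me :: "'a set \<Rightarrow> ('a \<Rightarrow> 'a \<Rightarrow> real) \<Rightarrow> ('a \<Rightarrow> 'a) \<Rightarrow> 'a rel" where
  "S_me X d T =
     (LEAST R. closed_invariant_equiv X d T R \<and> mean_equicontinuous_quotient X d T R)"

definition sensitive_in_mean ::
    "'a set \<Rightarrow> ('a \<Rightarrow> 'a \<Rightarrow> real) \<Rightarrow> ('a \<Rightarrow> 'a) \<Rightarrow> 'a \<Rightarrow> 'a \<Rightarrow> bool" where
  "sensitive_in_mean X d T x y \<longleftrightarrow>
     x = y \<or>
     (\<forall>\<tau>>0. \<exists>c>0. \<forall>\<epsilon>>0. \<exists>x'\<in>X. \<exists>y'\<in>X. \<exists>n\<ge>1::nat. d x' y' < \<epsilon> \<and>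
        (1 / real n) * real (card {i. i < n \<and> d ((T ^^ i) x') x < \<tau> \<and> d ((T ^^ i) y') y < \<tau>})
          > (c :: real))"

definition Q_me :: "'a set \<Rightarrow> ('a \<Rightarrow> 'a \<Rightarrow> real) \<Rightarrow> ('a \<Rightarrow> 'a) \<Rightarrow> 'a rel" where
  "Q_me X d T = {(x, y). x \<in> X \<and> y \<in> X \<and> sensitive_in_mean X d T x y}"

end

theory Submission
  imports Defs
begin

text \<open>
  The theorem follows once it is known that, for a closed invariant equivalence relation \<open>R\<close>, the
  quotient \<open>X // R\<close> is mean equicontinuous if and only if \<open>Q_me X d T \<subseteq> R\<close>: then \<open>S_me X d T\<close> is the
  intersection of all such \<open>R\<close>. A compatible metric of the quotient is pulled back to a continuous
  pseudometric \<open>D\<close> on \<open>X\<close> with zero set \<open>R\<close>.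

  Suppose the quotient is mean equicontinuous. The relation "the upper mean of \<open>D\<close> along the orbits is
  at most \<open>\<epsilon>\<close>" is closed and invariant, so by compactness every pair in it has, within a bounded time,
  a block of small average. Concatenating blocks bounds the averages over all times uniformly, which
  contradicts frequent visits to a neighbourhood of a pair off \<open>R\<close>.

  Conversely, if \<open>D\<close> vanishes on \<open>Q_me X d T\<close>, finitely many rarely visited boxes cover
  \<open>{(x, y). \<epsilon> \<le> D x y}\<close>, so all averages of \<open>D\<close> along the orbits of \<open>d\<close>-close points are small.
\<close>

section \<open>Metrizability of quotients of compact metric spaces\<close>

text \<open>The final topology of the projection. A metric on the classes is compatible in the sense
  of \<open>mean_equicontinuous_quotient\<close> exactly when it induces this topology.\<close>

definition quotient_space :: "'a topology \<Rightarrow> 'a rel \<Rightarrow> 'a set topology" where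
  "quotient_space X R =
     topology (\<lambda>U. U \<subseteq> topspace X // R \<and> openin X {x \<in> topspace X. R `` {x} \<in> U})"

lemma openin_quotient_space:
  "openin (quotient_space X R) U \<longleftrightarrow>
     U \<subseteq> topspace X // R \<and> openin X {x \<in> topspace X. R `` {x} \<in> U}"
proof -
  have "istopology (\<lambda>U. U \<subseteq> topspace X // R \<and> openin X {x \<in> topspace X. R `` {x} \<in> U})"
    unfolding istopology_def
  proof (intro conjI allI impI; (elim conjE)?)
    fix S T assume "openin X {x \<in> topspace X. R `` {x} \<in> S}" "openin X {x \<in> topspace X. R `` {x} \<in> T}"
    then have "openin X ({x \<in> topspace X. R `` {x} \<in> S} \<inter> {x \<in> topspace X. R `` {x} \<in> T})"
      by blast
    also have "\<dots> = {x \<in> topspace X. R `` {x} \<in> S \<inter> T}" by auto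
    finally show "openin X {x \<in> topspace X. R `` {x} \<in> S \<inter> T}" .
  next
    fix \<K> assume "\<forall>K\<in>\<K>. K \<subseteq> topspace X // R \<and> openin X {x \<in> topspace X. R `` {x} \<in> K}"
    then have "openin X (\<Union>K\<in>\<K>. {x \<in> topspace X. R `` {x} \<in> K})" by blast
    also have "\<dots> = {x \<in> topspace X. R `` {x} \<in> \<Union>\<K>}" by auto
    finally show "openin X {x \<in> topspace X. R `` {x} \<in> \<Union>\<K>}" .
  qed auto
  then show ?thesis by (simp add: quotient_space_def)
qed

lemma topspace_quotient_space [simp]: "topspace (quotient_space X R) = topspace X // R"
proof
  show "topspace (quotient_space X R) \<subseteq> topspace X // R"
    by (metis openin_quotient_space openin_topspace)
  have "{x \<in> topspace X. R `` {x} \<in> topspace X // R} = topspace X"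
    by (auto intro: quotientI)
  then have "openin (quotient_space X R) (topspace X // R)"
    by (simp add: openin_quotient_space)
  then show "topspace X // R \<subseteq> topspace (quotient_space X R)"
    by (rule openin_subset)
qed

lemma quotient_map_quotient_space: "quotient_map X (quotient_space X R) (\<lambda>x. R `` {x})"
  unfolding quotient_map_def by (auto simp: openin_quotient_space quotient_def)

text \<open>The image of \<open>C\<close> is the second projection of the part of \<open>R\<close>
  over \<open>C\<close>, and projection along a compact factor is a closed map.\<close>

lemma closedin_Image_compact:
  assumes "compact_space X" "closedin (prod_topology X Y) R" "closedin X C"
  shows "closedin Y (R `` C)"
proof -
  have "closedin (prod_topology X Y) (C \<times> topspace Y)"
    by (simp add: assms(3) closedin_prod_Times_iff)
  then have "closedin (prod_topology X Y) (R \<inter> (C \<times> topspace Y))"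
    using assms(2) by blast
  then have "closedin Y (snd ` (R \<inter> (C \<times> topspace Y)))"
    using closed_map_snd[OF assms(1)] by (auto simp: closed_map_def)
  moreover have "R \<subseteq> topspace X \<times> topspace Y"
    using closedin_subset[OF assms(2)] by simp
  then have "snd ` (R \<inter> (C \<times> topspace Y)) = R `` C" by force
  ultimately show ?thesis by simp
qed

text \<open>A set of classes is closed iff its preimage in \<open>X\<close> is. For the image of
  \<open>C\<close> this preimage is the saturation of \<open>C\<close> under \<open>R\<close>,
  closed by \<open>closedin_Image_compact\<close>.\<close>

lemma closed_map_quotient_space:
  assumes "compact_space X" "equiv (topspace X) R" "closedin (prod_topology X X) R"
  shows "closed_map X (quotient_space X R) (\<lambda>x. R `` {x})"
  unfolding closed_map_def
proof (intro allI impI)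
  fix C assume C: "closedin X C"
  have sub: "C \<subseteq> topspace X" using C by (rule closedin_subset)
  have "{x \<in> topspace X. R `` {x} \<in> (\<lambda>x. R `` {x}) ` C} = R `` C"
  proof (intro equalityI subsetI)
    fix x assume "x \<in> {x \<in> topspace X. R `` {x} \<in> (\<lambda>x. R `` {x}) ` C}"
    then obtain c where "x \<in> topspace X" "c \<in> C" "R `` {c} = R `` {x}" by auto
    then have "(c, x) \<in> R" using sub eq_equiv_class_iff[OF assms(2)] by blast
    with \<open>c \<in> C\<close> show "x \<in> R `` C" by blast
  next
    fix x assume "x \<in> R `` C"
    then obtain c where c: "c \<in> C" "(c, x) \<in> R" by blast
    moreover have "x \<in> topspace X"
      using c(2) closedin_subset[OF assms(3)] by auto
    moreover have "R `` {c} = R `` {x}"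
      using c(2) equiv_class_eq[OF assms(2)] by blast
    ultimately show "x \<in> {x \<in> topspace X. R `` {x} \<in> (\<lambda>x. R `` {x}) ` C}"
      by auto
  qed
  then have "closedin X {x \<in> topspace X. R `` {x} \<in> (\<lambda>x. R `` {x}) ` C}"
    using closedin_Image_compact[OF assms(1,3) C] by simp
  moreover have "(\<lambda>x. R `` {x}) ` C \<subseteq> topspace (quotient_space X R)"
    using sub by (auto intro: quotientI)
  ultimately show "closedin (quotient_space X R) ((\<lambda>x. R `` {x}) ` C)"
    using quotient_map_quotient_space[of X R] by (simp add: quotient_map_closedin)
qed

text \<open>Evaluation at the \<open>f i\<close> maps \<open>Y\<close> into a countable, hence
  metrizable, power of the line. Being injective and continuous from a compact space to a Hausdorff
  space, it is an embedding.\<close>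

lemma metrizable_space_countably_separated:
  fixes f :: "'i \<Rightarrow> 'b \<Rightarrow> real"
  assumes "compact_space Y" "countable I"
    and cont: "\<And>i. i \<in> I \<Longrightarrow> continuous_map Y euclideanreal (f i)"
    and sep: "\<And>x y. \<lbrakk>x \<in> topspace Y; y \<in> topspace Y; x \<noteq> y\<rbrakk> \<Longrightarrow> \<exists>i\<in>I. f i x \<noteq> f i y"
  shows "metrizable_space Y"
proof -
  let ?P = "product_topology (\<lambda>_::'i. euclideanreal) I"
  let ?F = "\<lambda>y. restrict (\<lambda>i. f i y) I"
  have P: "metrizable_space ?P"
    unfolding metrizable_space_product_topology
    using assms(2) metrizable_space_euclidean by (auto intro: countable_subset)
  have "continuous_map Y ?P ?F"
    using cont by (simp add: continuous_map_componentwise image_subset_iff)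
  moreover have "inj_on ?F (topspace Y)"
  proof (rule inj_onI, rule ccontr)
    fix x y assume *: "x \<in> topspace Y" "y \<in> topspace Y" "?F x = ?F y" "x \<noteq> y"
    then obtain i where "i \<in> I" "f i x \<noteq> f i y" using sep by blast
    with fun_cong[OF *(3), of i] show False by simp
  qed
  ultimately have "embedding_map Y ?P ?F"
    using assms(1) P by (intro continuous_imp_embedding_map metrizable_imp_Hausdorff_space)
  then have "Y homeomorphic_space subtopology ?P (?F ` topspace Y)"
    by (rule embedding_map_imp_homeomorphic_space)
  then show ?thesis
    using P homeomorphic_metrizable_space metrizable_space_subtopology by blast
qed

text \<open>Total boundedness gives a finite net at each scale 1/(n+1); their union is the dense
  set.\<close>

lemma (in Metric_space) countable_dense_centres:
  assumes "compact_space mtopology"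
  obtains A where "countable A" "A \<subseteq> M" "\<And>x r. \<lbrakk>x \<in> M; 0 < r\<rbrakk> \<Longrightarrow> \<exists>a\<in>A. d a x < r"
proof -
  have "mtotally_bounded M"
    using assms by (auto simp: compact_space_def intro: compactin_imp_mtotally_bounded)
  then have "\<forall>n. \<exists>K. finite K \<and> K \<subseteq> M \<and> M \<subseteq> (\<Union>x\<in>K. mball x (1 / real (Suc n)))"
    unfolding mtotally_bounded_def by simp
  then obtain K where K: "\<And>n. finite (K n)" "\<And>n. K n \<subseteq> M"
    "\<And>n. M \<subseteq> (\<Union>x\<in>K n. mball x (1 / real (Suc n)))" by metis
  show thesis
  proof
    show "countable (\<Union>n. K n)" "(\<Union>n. K n) \<subseteq> M"
      using K by (auto intro: countable_finite)
    fix x r assume "x \<in> M" "(0::real) < r"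
    then obtain n where n: "1 / real (Suc n) < r" using nat_approx_posE by blast
    obtain a where "a \<in> K n" "d a x < 1 / real (Suc n)"
      using K(3)[of n] \<open>x \<in> M\<close> by auto
    with n show "\<exists>a\<in>(\<Union>n. K n). d a x < r"
      by (intro bexI[of _ a]) auto
  qed
qed

text \<open>As a closed continuous image of a metric space the quotient is normal, so Urysohn's
  lemma applies. Countably many Urysohn functions, one for each pair of mutually inequivalent balls
  about points of a countable dense set, separate the classes.\<close>

lemma (in Metric_space) metrizable_space_quotient_space:
  assumes comp: "compact_space mtopology" and eqv: "equiv M R"
    and clo: "closedin (prod_topology mtopology mtopology) R"
  shows "metrizable_space (quotient_space mtopology R)" (is "metrizable_space ?Y")
proof -
  let ?\<pi> = "\<lambda>x. R `` {x}"
  have contpi: "continuous_map mtopology ?Y ?\<pi>"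
    by (rule quotient_imp_continuous_map[OF quotient_map_quotient_space])
  have surj: "?\<pi> ` topspace mtopology = topspace ?Y"
    by (rule quotient_imp_surjective_map[OF quotient_map_quotient_space])
  have clopi: "closed_map mtopology ?Y ?\<pi>"
    using comp eqv clo by (intro closed_map_quotient_space) simp_all
  have norm: "normal_space ?Y"
    using normal_space_continuous_closed_map_image[OF normal_space_mtopology contpi clopi surj] .
  have compY: "compact_space ?Y"
    using image_compactin[OF _ contpi, of "topspace mtopology"] comp
    by (simp add: compact_space_def surj del: topspace_mtopology topspace_quotient_space)
  obtain A where A: "countable A" "A \<subseteq> M" "\<And>x r. \<lbrakk>x \<in> M; 0 < r\<rbrakk> \<Longrightarrow> \<exists>a\<in>A. d a x < r"
    using countable_dense_centres[OF comp] by blast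
  \<comment> \<open>The balls are closed so that their images under the closed map
    \<open>?\<pi>\<close> are closed, as Urysohn's lemma requires.\<close>
  define B where "B a k = mcball a (1 / real (Suc k))" for a and k :: nat
  \<comment> \<open>No point of the first ball is equivalent to a point of the second, so the two
    images in the quotient are disjoint.\<close>
  define good where "good = (\<lambda>(a, b, k). (B a k \<times> B b k) \<inter> R = {})"
  define I where "I = {t \<in> A \<times> A \<times> UNIV. good t}"
  have "\<exists>f. continuous_map ?Y euclideanreal f \<and> f ` ?\<pi> ` B a k \<subseteq> {0} \<and> f ` ?\<pi> ` B b k \<subseteq> {1}"
    if "good (a, b, k)" for a b k
  proof -
    have disj: "disjnt (?\<pi> ` B a k) (?\<pi> ` B b k)"
    proof -
      { fix x y assume "x \<in> B a k" "y \<in> B b k" "R `` {x} = R `` {y}"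
        moreover from this have "x \<in> M" "y \<in> M" by (simp_all add: B_def)
        ultimately have "(x, y) \<in> (B a k \<times> B b k) \<inter> R"
          using eq_equiv_class_iff[OF eqv] by blast
        with that have False by (simp add: good_def) }
      then show ?thesis unfolding disjnt_def by blast
    qed
    have cl: "closedin ?Y (?\<pi> ` B a k)" for a
      using clopi by (auto simp: closed_map_def B_def closedin_mcball)
    show ?thesis
      by (rule Urysohn_lemma_alt[OF norm cl[of a] cl[of b] disj, of 0 1]) (intro exI conjI)
  qed
  note Urysohn_ex = this
  define g where "g a b k = (SOME f. continuous_map ?Y euclideanreal f \<and>
      f ` ?\<pi> ` B a k \<subseteq> {0} \<and> f ` ?\<pi> ` B b k \<subseteq> {1::real})" for a b k
  have g: "continuous_map ?Y euclideanreal (g a b k) \<and>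
      g a b k ` ?\<pi> ` B a k \<subseteq> {0} \<and> g a b k ` ?\<pi> ` B b k \<subseteq> {1}" if "good (a, b, k)" for a b k
    unfolding g_def by (rule someI_ex[OF Urysohn_ex[OF that]])
  define f where "f = (\<lambda>(a, b, k). g a b k)"
  have f: "\<And>t. t \<in> I \<Longrightarrow> continuous_map ?Y euclideanreal (f t)"
    using g by (auto simp: f_def I_def)
  show ?thesis
  proof (rule metrizable_space_countably_separated[OF compY])
    have "countable (A \<times> A \<times> (UNIV::nat set))"
      using A(1) by (intro countable_SIGMA) auto
    then show "countable I"
      by (rule countable_subset[rotated]) (auto simp: I_def)
    show "\<And>i. i \<in> I \<Longrightarrow> continuous_map ?Y euclideanreal (f i)" by (rule f)
    fix P Q assume PQ: "P \<in> topspace ?Y" "Q \<in> topspace ?Y" "P \<noteq> Q"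
    then obtain x y where xy: "x \<in> M" "y \<in> M" "P = R `` {x}" "Q = R `` {y}"
      by (auto elim!: quotientE)
    have "(x, y) \<notin> R" using PQ(3) xy eq_equiv_class_iff[OF eqv] by blast
    moreover have "openin (prod_topology mtopology mtopology) (M \<times> M - R)"
      using openin_diff[OF openin_topspace clo] by simp
    ultimately obtain U V where UV: "openin mtopology U" "openin mtopology V" "x \<in> U" "y \<in> V" "U \<times> V \<subseteq> M \<times> M - R"
      unfolding openin_prod_topology_alt using xy by (metis DiffI mem_Sigma_iff)
    obtain r where r: "r > 0" "mball x r \<subseteq> U" using UV unfolding openin_mtopology by blast
    obtain s where s: "s > 0" "mball y s \<subseteq> V" using UV unfolding openin_mtopology by blast
    \<comment> \<open>Half the smaller radius: a ball of radius 1/(k+1) whose centre is that close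
      to \<open>x\<close> stays inside \<open>mball x r\<close>, and likewise at
      \<open>y\<close>.\<close>
    obtain k where k: "1 / real (Suc k) < min r s / 2"
      using nat_approx_posE[of "min r s / 2"] r s by auto
    obtain a where a: "a \<in> A" "d a x < 1 / real (Suc k)" using A(3)[OF xy(1), of "1 / real (Suc k)"] by auto
    obtain b where b: "b \<in> A" "d b y < 1 / real (Suc k)" using A(3)[OF xy(2), of "1 / real (Suc k)"] by auto
    have "B a k \<subseteq> mball x r"
    proof
      fix z assume z: "z \<in> B a k"
      then have "d x z \<le> d a x + d a z" using xy by (intro triangle'') (auto simp: B_def)
      with z a k xy show "z \<in> mball x r" by (auto simp: B_def)
    qed
    moreover have "B b k \<subseteq> mball y s"
    proof
      fix z assume z: "z \<in> B b k"
      then have "d y z \<le> d b y + d b z" using xy by (intro triangle'') (auto simp: B_def)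
      with z b k xy show "z \<in> mball y s" by (auto simp: B_def)
    qed
    ultimately have "good (a, b, k)" using r s UV(5) unfolding good_def by blast
    then have I: "(a, b, k) \<in> I" using a b by (simp add: I_def)
    have "x \<in> B a k" "y \<in> B b k" using a b xy A(2) by (auto simp: B_def)
    then have "f (a, b, k) P = 0" "f (a, b, k) Q = 1" using g[OF \<open>good (a, b, k)\<close>] xy by (auto simp: f_def image_subset_iff)
    then show "\<exists>i\<in>I. f i P \<noteq> f i Q" using I by force
  qed
qed

section \<open>Averages of a pseudometric along orbits\<close>

lemma sensitive_in_meanD:
  assumes "sensitive_in_mean X d T x y" "x \<noteq> y" "0 < \<tau>"
  shows "\<exists>c>0. \<forall>\<epsilon>>0. \<exists>x'\<in>X. \<exists>y'\<in>X. \<exists>n\<ge>1::nat. d x' y' < \<epsilon> \<and>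
    (1 / real n) * real (card {i. i < n \<and> d ((T ^^ i) x') x < \<tau> \<and> d ((T ^^ i) y') y < \<tau>}) > c"
  using assms(1)[unfolded sensitive_in_mean_def]
proof
  assume "\<forall>\<tau>>0. \<exists>c>0. \<forall>\<epsilon>>0. \<exists>x'\<in>X. \<exists>y'\<in>X. \<exists>n\<ge>1::nat. d x' y' < \<epsilon> \<and>
    (1 / real n) * real (card {i. i < n \<and> d ((T ^^ i) x') x < \<tau> \<and> d ((T ^^ i) y') y < \<tau>}) > c"
  from this[rule_format, OF assms(3)] show ?thesis .
qed (use assms(2) in blast)

text \<open>\<open>D\<close> is a bounded pseudometric that may vanish off the diagonal. Continuity
  of \<open>T\<close> and \<open>D\<close> enters in uniform \<epsilon>-\<delta> form, the only form
  in which the estimates use it.\<close>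

locale observed_system = Metric_space X d
  for X :: "'a set" and d :: "'a \<Rightarrow> 'a \<Rightarrow> real" +
  fixes T :: "'a \<Rightarrow> 'a" and D :: "'a \<Rightarrow> 'a \<Rightarrow> real" and K :: real
  assumes compact_X: "compact_space mtopology"
    and T_closed: "x \<in> X \<Longrightarrow> T x \<in> X"
    and T_unif: "0 < \<epsilon> \<Longrightarrow> \<exists>\<delta>>0. \<forall>x\<in>X. \<forall>y\<in>X. d x y < \<delta> \<longrightarrow> d (T x) (T y) < \<epsilon>"
    and D_nonneg: "0 \<le> D x y"
    and D_commute: "D x y = D y x"
    and D_refl: "x \<in> X \<Longrightarrow> D x x = 0"
    and D_triangle: "\<lbrakk>x \<in> X; y \<in> X; z \<in> X\<rbrakk> \<Longrightarrow> D x z \<le> D x y + D y z"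
    and D_unif: "0 < \<epsilon> \<Longrightarrow> \<exists>\<delta>>0. \<forall>x\<in>X. \<forall>y\<in>X. d x y < \<delta> \<longrightarrow> D x y < \<epsilon>"
    and D_bound: "\<lbrakk>x \<in> X; y \<in> X\<rbrakk> \<Longrightarrow> D x y \<le> K"
begin

text \<open>Not divided by \<open>n\<close>, so that it is additive over consecutive blocks of
  time.\<close>

definition orbit_sum :: "nat \<Rightarrow> 'a \<Rightarrow> 'a \<Rightarrow> real" where
  "orbit_sum n x y = (\<Sum>i<n. D ((T ^^ i) x) ((T ^^ i) y))"

text \<open>The bound is required at every time and not only in the limit; \<open>n = 0\<close> is
  excluded because the strict inequality fails there.\<close>

definition equicontinuous_in_the_mean :: bool where
  "equicontinuous_in_the_mean \<longleftrightarrow>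
     (\<forall>\<epsilon>>0. \<exists>\<delta>>0. \<forall>x\<in>X. \<forall>y\<in>X. d x y < \<delta> \<longrightarrow> (\<forall>n\<ge>1. orbit_sum n x y < \<epsilon> * real n))"

text \<open>Implied by an upper mean below \<epsilon> and implying an upper mean of at most
  \<epsilon>, without division or limits.\<close>

definition mean_close :: "real \<Rightarrow> 'a \<Rightarrow> 'a \<Rightarrow> bool" where
  "mean_close \<epsilon> x y \<longleftrightarrow> (\<forall>\<^sub>F n in sequentially. orbit_sum n x y < \<epsilon> * real n)"

section \<open>Uniform continuity of iterates and calculus of orbit sums\<close>

lemma funpow_closed: "x \<in> X \<Longrightarrow> (T ^^ i) x \<in> X"
  by (induction i) (auto simp: T_closed)

lemma funpow_unif: "0 < \<epsilon> \<Longrightarrow> \<exists>\<delta>>0. \<forall>x\<in>X. \<forall>y\<in>X. d x y < \<delta> \<longrightarrow> d ((T ^^ i) x) ((T ^^ i) y) < \<epsilon>"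
proof (induction i arbitrary: \<epsilon>)
  case 0 then show ?case by auto
next
  case (Suc i)
  obtain \<eta> where "\<eta> > 0" "\<forall>x\<in>X. \<forall>y\<in>X. d x y < \<eta> \<longrightarrow> d (T x) (T y) < \<epsilon>"
    using T_unif[OF Suc.prems] by blast
  moreover obtain \<delta> where "\<delta> > 0" "\<forall>x\<in>X. \<forall>y\<in>X. d x y < \<delta> \<longrightarrow> d ((T ^^ i) x) ((T ^^ i) y) < \<eta>"
    using Suc.IH[OF \<open>\<eta> > 0\<close>] by blast
  ultimately show ?case by (intro exI[of _ \<delta>]) (simp add: funpow_closed)
qed

lemma observable_unif:
  assumes "0 < \<epsilon>"
  shows "\<exists>\<delta>>0. \<forall>x\<in>X. \<forall>y\<in>X. d x y < \<delta> \<longrightarrow> D ((T ^^ i) x) ((T ^^ i) y) < \<epsilon>"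
proof -
  obtain \<eta> where "\<eta> > 0" "\<forall>x\<in>X. \<forall>y\<in>X. d x y < \<eta> \<longrightarrow> D x y < \<epsilon>"
    using D_unif[OF assms] by blast
  then show ?thesis using funpow_unif[of \<eta> i] funpow_closed by meson
qed

lemma observable_unif_initial:
  assumes "0 < \<epsilon>"
  shows "\<exists>\<delta>>0. \<forall>x\<in>X. \<forall>y\<in>X. d x y < \<delta> \<longrightarrow> (\<forall>i<n. D ((T ^^ i) x) ((T ^^ i) y) < \<epsilon>)"
proof (induction n)
  case 0 show ?case by (auto intro: exI[of _ 1])
next
  case (Suc n)
  then obtain \<delta> where \<delta>: "\<delta> > 0"
    "\<forall>x\<in>X. \<forall>y\<in>X. d x y < \<delta> \<longrightarrow> (\<forall>i<n. D ((T ^^ i) x) ((T ^^ i) y) < \<epsilon>)" by blast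
  obtain \<eta> where \<eta>: "\<eta> > 0" "\<forall>x\<in>X. \<forall>y\<in>X. d x y < \<eta> \<longrightarrow> D ((T ^^ n) x) ((T ^^ n) y) < \<epsilon>"
    using observable_unif[OF assms] by blast
  show ?case
    using \<delta> \<eta> by (intro exI[of _ "min \<delta> \<eta>"]) (auto simp: less_Suc_eq)
qed

lemma orbit_sum_nonneg: "0 \<le> orbit_sum n x y"
  by (simp add: orbit_sum_def sum_nonneg D_nonneg)

lemma orbit_sum_commute: "orbit_sum n x y = orbit_sum n y x"
  by (simp add: orbit_sum_def D_commute)

lemma orbit_sum_triangle:
  assumes "x \<in> X" "y \<in> X" "z \<in> X"
  shows "orbit_sum n x z \<le> orbit_sum n x y + orbit_sum n y z"
  unfolding orbit_sum_def sum.distrib[symmetric]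
  by (intro sum_mono D_triangle funpow_closed assms)

lemma orbit_sum_add:
  "orbit_sum (m + n) x y = orbit_sum m x y + orbit_sum n ((T ^^ m) x) ((T ^^ m) y)"
  by (induction n) (simp_all add: orbit_sum_def funpow_add add.commute)

lemma orbit_sum_le: "x \<in> X \<Longrightarrow> y \<in> X \<Longrightarrow> orbit_sum n x y \<le> real n * K"
  using sum_bounded_above[of "{..<n}" "\<lambda>i. D ((T ^^ i) x) ((T ^^ i) y)" K]
  by (simp add: orbit_sum_def D_bound funpow_closed)

lemma K_nonneg: "x \<in> X \<Longrightarrow> 0 \<le> K"
  using D_bound[of x x] D_refl[of x] by simp

lemma orbit_sum_unif:
  assumes "0 < \<epsilon>"
  shows "\<exists>\<delta>>0. \<forall>x\<in>X. \<forall>y\<in>X. d x y < \<delta> \<longrightarrow> orbit_sum n x y < \<epsilon>"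
proof -
  \<comment> \<open>Dividing by \<open>n + 1\<close> keeps the sum of \<open>n\<close> terms
    strictly below \<epsilon> and covers \<open>n = 0\<close>.\<close>
  obtain \<delta> where \<delta>: "\<delta> > 0" "\<forall>x\<in>X. \<forall>y\<in>X. d x y < \<delta> \<longrightarrow> (\<forall>i<n. D ((T ^^ i) x) ((T ^^ i) y) < \<epsilon> / (n + 1))"
    using observable_unif_initial[of "\<epsilon> / (n + 1)" n] assms by auto
  show ?thesis
  proof (intro exI[of _ \<delta>] conjI ballI impI)
    fix x y assume "x \<in> X" "y \<in> X" "d x y < \<delta>"
    then have "\<And>i. i < n \<Longrightarrow> D ((T ^^ i) x) ((T ^^ i) y) \<le> \<epsilon> / (n + 1)" using \<delta> by (meson less_imp_le)
    then have "orbit_sum n x y \<le> real n * (\<epsilon> / (n + 1))"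
      using sum_bounded_above[of "{..<n}" "\<lambda>i. D ((T ^^ i) x) ((T ^^ i) y)" "\<epsilon> / (n + 1)"]
      by (simp add: orbit_sum_def)
    also have "\<dots> < \<epsilon>" using assms by (simp add: field_simps)
    finally show "orbit_sum n x y < \<epsilon>" .
  qed (fact \<delta>)
qed

section \<open>Asymptotic closeness of orbits\<close>

lemma mean_close_commute: "mean_close \<epsilon> x y \<Longrightarrow> mean_close \<epsilon> y x"
  by (simp add: mean_close_def orbit_sum_commute)

lemma mean_close_triangle:
  assumes "mean_close \<epsilon> x y" "mean_close \<eta> y z" "x \<in> X" "y \<in> X" "z \<in> X"
  shows "mean_close (\<epsilon> + \<eta>) x z"
  using assms(1,2) unfolding mean_close_def
proof eventually_elim
  case (elim n)
  with orbit_sum_triangle[OF assms(3-5), of n] show ?case by (simp add: distrib_right)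
qed

text \<open>The shifted sum of length \<open>n\<close> is a tail of the sum of length
  \<open>i + n\<close>, and \<open>i + n\<close> is at most \<open>2 * n\<close> once
  \<open>n\<close> reaches \<open>i\<close>. The factor 2 is thus the same for all
  \<open>i\<close>.\<close>

lemma mean_close_funpow:
  assumes "mean_close \<epsilon> x y" "0 < \<epsilon>"
  shows "mean_close (2 * \<epsilon>) ((T ^^ i) x) ((T ^^ i) y)"
proof -
  have "\<forall>\<^sub>F n in sequentially. orbit_sum (i + n) x y < \<epsilon> * real (i + n)"
    using eventually_sequentially_seg[of "\<lambda>n. orbit_sum n x y < \<epsilon> * real n" i] assms(1)
    by (simp add: mean_close_def add.commute)
  then show ?thesis
    unfolding mean_close_def using eventually_ge_at_top[of i]
  proof eventually_elim
    case (elim n)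
    have "orbit_sum n ((T ^^ i) x) ((T ^^ i) y) \<le> orbit_sum (i + n) x y"
      using orbit_sum_add[of i n x y] orbit_sum_nonneg[of i x y] by simp
    also have "\<dots> < \<epsilon> * real (i + n)" by (fact elim)
    also have "\<dots> \<le> \<epsilon> * (2 * real n)" using elim assms(2) by (intro mult_left_mono) auto
    finally show ?case by simp
  qed
qed

text \<open>Two successive extractions give a convergent subsequence of pairs. The conclusion only
  records a cluster point, so that no subsequence has to be carried along.\<close>

lemma pair_subsequence:
  fixes u v :: "nat \<Rightarrow> 'a"
  assumes "\<And>n. u n \<in> X" "\<And>n. v n \<in> X"
  obtains x y where "x \<in> X" "y \<in> X"
    "\<And>\<epsilon> N. 0 < \<epsilon> \<Longrightarrow> \<exists>n\<ge>N. d (u n) x < \<epsilon> \<and> d (v n) y < \<epsilon>"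
proof -
  obtain x and r :: "nat \<Rightarrow> nat" where x: "x \<in> X" "strict_mono r" "limitin mtopology (u \<circ> r) x sequentially"
    using compact_X assms(1) unfolding compact_space_sequentially by (metis image_subsetI)
  obtain y and s :: "nat \<Rightarrow> nat" where y: "y \<in> X" "strict_mono s" "limitin mtopology (v \<circ> r \<circ> s) y sequentially"
    using compact_X assms(2) unfolding compact_space_sequentially
    by (metis (no_types, lifting) comp_apply image_subsetI)
  show thesis
  proof
    show "x \<in> X" "y \<in> X" by fact+
    fix \<epsilon> :: real and N :: nat assume "0 < \<epsilon>"
    have "limitin mtopology (u \<circ> r \<circ> s) x sequentially"
      using limitin_subsequence[OF y(2) x(3)] .
    then have "\<forall>\<^sub>F n in sequentially. d (u (r (s n))) x < \<epsilon>"
      using \<open>0 < \<epsilon>\<close> by (auto simp: limitin_metric elim!: allE[of _ \<epsilon>] eventually_mono)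
    moreover have "\<forall>\<^sub>F n in sequentially. d (v (r (s n))) y < \<epsilon>"
      using y(3) \<open>0 < \<epsilon>\<close> by (auto simp: limitin_metric elim!: allE[of _ \<epsilon>] eventually_mono)
    moreover have "\<forall>\<^sub>F n in sequentially. n \<ge> N" by (rule eventually_ge_at_top)
    ultimately have "\<forall>\<^sub>F n in sequentially. d (u (r (s n))) x < \<epsilon> \<and> d (v (r (s n))) y < \<epsilon> \<and> n \<ge> N"
      by eventually_elim simp
    then obtain n where "d (u (r (s n))) x < \<epsilon>" "d (v (r (s n))) y < \<epsilon>" "n \<ge> N"
      unfolding eventually_sequentially by blast
    moreover have "r (s n) \<ge> n"
      using seq_suble[OF x(2)] seq_suble[OF y(2)] order_trans by blast
    ultimately show "\<exists>n\<ge>N. d (u n) x < \<epsilon> \<and> d (v n) y < \<epsilon>"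
      by (intro exI[of _ "r (s n)"]) auto
  qed
qed

text \<open>Counterexamples for every \<open>N\<close> would accumulate at some pair. That pair is
  still asymptotically close, so it has one time with a small average; by continuity the same time
  works for nearby counterexamples, however large their index.\<close>

lemma ex_small_block:
  assumes "0 < \<epsilon>"
    and mc: "\<And>\<epsilon>. 0 < \<epsilon> \<Longrightarrow> \<exists>\<delta>>0. \<forall>x\<in>X. \<forall>y\<in>X. d x y < \<delta> \<longrightarrow> mean_close \<epsilon> x y"
  shows "\<exists>N. \<forall>x\<in>X. \<forall>y\<in>X. mean_close (2 * \<epsilon>) x y \<longrightarrow>
    (\<exists>n. 1 \<le> n \<and> n \<le> N \<and> orbit_sum n x y \<le> 5 * \<epsilon> * real n)"
proof (rule ccontr)
  assume "\<not> ?thesis"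
  then have "\<forall>N. \<exists>x\<in>X. \<exists>y\<in>X. mean_close (2 * \<epsilon>) x y \<and>
      (\<forall>n. 1 \<le> n \<and> n \<le> N \<longrightarrow> 5 * \<epsilon> * real n < orbit_sum n x y)"
    by (meson not_le)
  then obtain u v where uv: "\<And>N. u N \<in> X" "\<And>N. v N \<in> X"
    "\<And>N. mean_close (2 * \<epsilon>) (u N) (v N)"
    "\<And>N n. \<lbrakk>1 \<le> n; n \<le> N\<rbrakk> \<Longrightarrow> 5 * \<epsilon> * real n < orbit_sum n (u N) (v N)"
    by metis
  obtain x y where xy: "x \<in> X" "y \<in> X"
    "\<And>\<epsilon> N. 0 < \<epsilon> \<Longrightarrow> \<exists>n\<ge>N. d (u n) x < \<epsilon> \<and> d (v n) y < \<epsilon>"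
    using pair_subsequence[of u v] uv by metis
  obtain \<delta> where \<delta>: "\<delta> > 0" "\<forall>x\<in>X. \<forall>y\<in>X. d x y < \<delta> \<longrightarrow> mean_close \<epsilon> x y"
    using mc[OF assms(1)] by blast
  obtain N where N: "d (u N) x < \<delta>" "d (v N) y < \<delta>" using xy(3)[OF \<delta>(1)] by blast
  \<comment> \<open>The path from \<open>x\<close> to \<open>y\<close> through \<open>u N\<close>
    and \<open>v N\<close>: the two end pieces are \<open>d\<close>-close and cost \<epsilon>
    each.\<close>
  have "mean_close (\<epsilon> + (2 * \<epsilon> + \<epsilon>)) x y"
    using \<delta> N xy uv
    by (intro mean_close_triangle[of _ x "u N" _ y] mean_close_triangle[of _ "u N" "v N" _ y])
      (auto intro: mean_close_commute)
  then have "\<forall>\<^sub>F n in sequentially. 1 \<le> n \<and> orbit_sum n x y < 4 * \<epsilon> * real n"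
    unfolding mean_close_def by (intro eventually_conj eventually_ge_at_top) (simp add: algebra_simps)
  then obtain n where n: "n \<ge> 1" "orbit_sum n x y < 4 * \<epsilon> * real n"
    unfolding eventually_sequentially by blast
  \<comment> \<open>With \<open>n\<close> now fixed, its orbit sum is uniformly continuous. The two
    errors of \<epsilon>/2 fit into the gap between \<open>4 * \<epsilon> * n\<close> and
    \<open>5 * \<epsilon> * n\<close>, as \<open>n\<close> is at least 1.\<close>
  obtain \<eta> where \<eta>: "\<eta> > 0" "\<forall>x\<in>X. \<forall>y\<in>X. d x y < \<eta> \<longrightarrow> orbit_sum n x y < \<epsilon> / 2"
    using orbit_sum_unif[of "\<epsilon> / 2" n] assms(1) by auto
  obtain m where m: "m \<ge> n" "d (u m) x < \<eta>" "d (v m) y < \<eta>" using xy(3)[OF \<eta>(1)] by blast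
  have "orbit_sum n (u m) (v m) \<le> orbit_sum n (u m) x + (orbit_sum n x y + orbit_sum n y (v m))"
    using orbit_sum_triangle[of "u m" x "v m" n] orbit_sum_triangle[of x y "v m" n] xy uv by force
  also have "\<dots> \<le> \<epsilon> / 2 + (4 * \<epsilon> * real n + \<epsilon> / 2)"
    using \<eta>(2) m n(2) xy uv by (intro add_mono) (auto simp: orbit_sum_commute[of n y] less_imp_le)
  also have "\<dots> \<le> 5 * \<epsilon> * real n" using n(1) assms(1) by simp
  finally show False using uv(4)[OF n(1) m(1)] by simp
qed

text \<open>Cut off one block of small average and restart at its end, where \<open>P\<close> still
  holds. Only the last, incomplete block is estimated trivially; it has fewer than \<open>N\<close>
  terms of size at most \<open>K\<close>.\<close>

lemma orbit_sum_block_bound: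
  assumes block: "\<And>x y. \<lbrakk>x \<in> X; y \<in> X; P x y\<rbrakk> \<Longrightarrow>
      \<exists>n. 1 \<le> n \<and> n \<le> N \<and> orbit_sum n x y \<le> c * real n"
    and "\<And>i. P ((T ^^ i) x) ((T ^^ i) y)" "x \<in> X" "y \<in> X" "0 \<le> c"
  shows "orbit_sum n x y \<le> c * real n + real N * K"
  using assms(2-4)
proof (induction n arbitrary: x y rule: less_induct)
  case (less n)
  obtain m where m: "1 \<le> m" "m \<le> N" "orbit_sum m x y \<le> c * real m"
    using block[OF less.prems(2,3)] less.prems(1)[of 0] by auto
  show ?case
  proof (cases "n < m")
    case True
    have "orbit_sum n x y \<le> real n * K" by (rule orbit_sum_le[OF less.prems(2,3)])
    also have "\<dots> \<le> real N * K"
      using True m K_nonneg[OF less.prems(2)] by (intro mult_right_mono) auto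
    finally show ?thesis using assms(5) by (simp add: add_increasing)
  next
    case False
    have "orbit_sum (n - m) ((T ^^ m) x) ((T ^^ m) y) \<le> c * real (n - m) + real N * K"
    proof (rule less.IH)
      show "n - m < n" using m False by auto
      show "P ((T ^^ i) ((T ^^ m) x)) ((T ^^ i) ((T ^^ m) y))" for i
        using less.prems(1)[of "i + m"] by (simp add: funpow_add)
    qed (use less.prems funpow_closed in auto)
    moreover have "orbit_sum n x y = orbit_sum m x y + orbit_sum (n - m) ((T ^^ m) x) ((T ^^ m) y)"
      using orbit_sum_add[of m "n - m" x y] False by simp
    moreover have "c * real m + c * real (n - m) = c * real n"
      using False by (simp add: algebra_simps of_nat_diff)
    ultimately show ?thesis using m(3) by linarith
  qed
qed

text \<open>At long times the remainder \<open>N * K\<close> of the block bound is negligible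
  against \<open>n\<close>; the finitely many short times are controlled by continuity of the
  iterates.\<close>

lemma mean_close_imp_equicontinuous_in_the_mean:
  assumes mc: "\<And>\<epsilon>. 0 < \<epsilon> \<Longrightarrow> \<exists>\<delta>>0. \<forall>x\<in>X. \<forall>y\<in>X. d x y < \<delta> \<longrightarrow> mean_close \<epsilon> x y"
  shows equicontinuous_in_the_mean
  unfolding equicontinuous_in_the_mean_def
proof (intro allI impI)
  fix \<epsilon>' :: real assume "0 < \<epsilon>'"
  \<comment> \<open>The blocks cost \<open>5 * \<epsilon>\<close> and the remainder one more
    \<epsilon>; a seventh leaves room for strictness.\<close>
  define \<epsilon> where "\<epsilon> = \<epsilon>' / 7"
  have "0 < \<epsilon>" using \<open>0 < \<epsilon>'\<close> by (simp add: \<epsilon>_def)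
  obtain N where N: "\<And>x y. \<lbrakk>x \<in> X; y \<in> X; mean_close (2 * \<epsilon>) x y\<rbrakk> \<Longrightarrow>
      \<exists>n. 1 \<le> n \<and> n \<le> N \<and> orbit_sum n x y \<le> 5 * \<epsilon> * real n"
    using ex_small_block[OF \<open>0 < \<epsilon>\<close> mc] by blast
  \<comment> \<open>From time \<open>N'\<close> on, the remainder \<open>N * K\<close> is at most
    \<open>\<epsilon> * n\<close>.\<close>
  obtain N' where N': "real N * K / \<epsilon> \<le> real N'" using real_arch_simple by blast
  obtain \<delta> where \<delta>: "\<delta> > 0" "\<forall>x\<in>X. \<forall>y\<in>X. d x y < \<delta> \<longrightarrow> mean_close \<epsilon> x y"
    using mc[OF \<open>0 < \<epsilon>\<close>] by blast
  obtain \<eta> where \<eta>: "\<eta> > 0" "\<forall>x\<in>X. \<forall>y\<in>X. d x y < \<eta> \<longrightarrow> (\<forall>i<N'. D ((T ^^ i) x) ((T ^^ i) y) < \<epsilon>)"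
    using observable_unif_initial[OF \<open>0 < \<epsilon>\<close>] by blast
  show "\<exists>\<delta>>0. \<forall>x\<in>X. \<forall>y\<in>X. d x y < \<delta> \<longrightarrow> (\<forall>n\<ge>1. orbit_sum n x y < \<epsilon>' * real n)"
  proof (intro exI[of _ "min \<delta> \<eta>"] conjI ballI allI impI)
    show "0 < min \<delta> \<eta>" using \<delta> \<eta> by simp
    fix x y :: 'a and n :: nat
    assume xy: "x \<in> X" "y \<in> X" "d x y < min \<delta> \<eta>" and n: "1 \<le> n"
    have "orbit_sum n x y \<le> 6 * \<epsilon> * real n"
    proof (cases "n < N'")
      case True
      have "orbit_sum n x y \<le> real n * \<epsilon>"
        using sum_bounded_above[of "{..<n}" "\<lambda>i. D ((T ^^ i) x) ((T ^^ i) y)" \<epsilon>] True xy \<eta>(2)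
        by (force simp: orbit_sum_def less_imp_le)
      also have "\<dots> \<le> 6 * \<epsilon> * real n" using \<open>0 < \<epsilon>\<close> by simp
      finally show ?thesis .
    next
      case False
      \<comment> \<open>The level \<open>2 * \<epsilon>\<close> persists along the whole orbit, so a
        new block can start after each one.\<close>
      have "mean_close (2 * \<epsilon>) ((T ^^ i) x) ((T ^^ i) y)" for i
        using \<delta>(2) xy \<open>0 < \<epsilon>\<close> by (intro mean_close_funpow) auto
      then have "orbit_sum n x y \<le> 5 * \<epsilon> * real n + real N * K"
        using xy \<open>0 < \<epsilon>\<close> N by (intro orbit_sum_block_bound[where P = "mean_close (2 * \<epsilon>)"]) auto
      moreover have "real N * K \<le> \<epsilon> * real N'" using N' \<open>0 < \<epsilon>\<close> by (simp add: field_simps)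
      moreover have "\<epsilon> * real N' \<le> \<epsilon> * real n" using False \<open>0 < \<epsilon>\<close> by simp
      ultimately show ?thesis by (simp add: algebra_simps)
    qed
    also have "\<dots> < \<epsilon>' * real n" using \<open>0 < \<epsilon>\<close> n by (simp add: \<epsilon>_def)
    finally show "orbit_sum n x y < \<epsilon>' * real n" .
  qed
qed

text \<open>If \<open>D x y\<close> is positive, \<open>D\<close> is bounded below near
  \<open>(x, y)\<close>, so visits with frequency above \<open>c\<close> force an average above a
  fixed positive level, for starting points arbitrarily close together.\<close>

lemma equicontinuous_in_the_mean_imp_zero_on_Q_me:
  assumes equicontinuous_in_the_mean and xy: "(x, y) \<in> Q_me X d T"
  shows "D x y = 0"
proof (rule ccontr)
  assume "D x y \<noteq> 0"
  \<comment> \<open>Moving from \<open>(x, y)\<close> to a visiting pair loses less than a third at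
    each end, so a third remains.\<close>
  define \<eta> where "\<eta> = D x y / 3"
  have "x \<in> X" "y \<in> X" "x \<noteq> y" using xy D_refl \<open>D x y \<noteq> 0\<close> by (auto simp: Q_me_def)
  have "\<eta> > 0" using \<open>D x y \<noteq> 0\<close> D_nonneg[of x y] by (simp add: \<eta>_def)
  obtain \<tau> where \<tau>: "\<tau> > 0" "\<forall>x\<in>X. \<forall>y\<in>X. d x y < \<tau> \<longrightarrow> D x y < \<eta>"
    using D_unif[OF \<open>\<eta> > 0\<close>] by blast
  obtain c where c: "c > 0" "\<forall>\<epsilon>>0. \<exists>x'\<in>X. \<exists>y'\<in>X. \<exists>n\<ge>1::nat. d x' y' < \<epsilon> \<and>
      (1 / real n) * real (card {i. i < n \<and> d ((T ^^ i) x') x < \<tau> \<and> d ((T ^^ i) y') y < \<tau>}) > c"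
  proof -
    have "sensitive_in_mean X d T x y" using xy by (simp add: Q_me_def)
    from sensitive_in_meanD[OF this \<open>x \<noteq> y\<close> \<tau>(1)] that show thesis by blast
  qed
  \<comment> \<open>The frequency \<open>c\<close> depends on \<open>\<tau>\<close> only, so
    \<delta> may be chosen after it and then used as the distance in the sensitivity
    condition.\<close>
  obtain \<delta> where \<delta>: "\<delta> > 0"
    "\<forall>x\<in>X. \<forall>y\<in>X. d x y < \<delta> \<longrightarrow> (\<forall>n\<ge>1. orbit_sum n x y < c * \<eta> * real n)"
    using assms(1)[unfolded equicontinuous_in_the_mean_def, rule_format, of "c * \<eta>"] c(1) \<open>\<eta> > 0\<close>
    by auto
  obtain x' y' n where x': "x' \<in> X" "y' \<in> X" "1 \<le> n" "d x' y' < \<delta>" and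
    card: "(1 / real n) * real (card {i. i < n \<and> d ((T ^^ i) x') x < \<tau> \<and> d ((T ^^ i) y') y < \<tau>}) > c"
    using c(2)[rule_format, OF \<delta>(1)] by blast
  let ?I = "{i. i < n \<and> d ((T ^^ i) x') x < \<tau> \<and> d ((T ^^ i) y') y < \<tau>}"
  have "c * real n < real (card ?I)" using card x'(3) by (simp add: field_simps)
  then have "c * \<eta> * real n < real (card ?I) * \<eta>"
    using mult_strict_right_mono[of "c * real n" "real (card ?I)" \<eta>] \<open>\<eta> > 0\<close> by (simp add: mult_ac)
  also have "\<dots> \<le> (\<Sum>i\<in>?I. D ((T ^^ i) x') ((T ^^ i) y'))"
  proof (rule sum_bounded_below)
    fix i assume i: "i \<in> ?I"
    let ?a = "(T ^^ i) x'" and ?b = "(T ^^ i) y'"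
    have ab: "?a \<in> X" "?b \<in> X" using x' funpow_closed by auto
    have "D ?a x < \<eta>" "D ?b y < \<eta>" using i \<tau>(2) ab \<open>x \<in> X\<close> \<open>y \<in> X\<close> by auto
    moreover have "D x y \<le> D x ?a + (D ?a ?b + D ?b y)"
      using D_triangle[of x ?a y] D_triangle[of ?a ?b y] ab \<open>x \<in> X\<close> \<open>y \<in> X\<close> by linarith
    ultimately show "\<eta> \<le> D ?a ?b" using D_commute[of x ?a] by (simp add: \<eta>_def)
  qed
  also have "\<dots> \<le> orbit_sum n x' y'"
    unfolding orbit_sum_def by (intro sum_mono2) (auto simp: D_nonneg)
  finally have "c * \<eta> * real n < orbit_sum n x' y'" .
  moreover have "orbit_sum n x' y' < c * \<eta> * real n" using \<delta>(2) x' by blast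
  ultimately show False by simp
qed

section \<open>Rarely visited sets\<close>

definition visits :: "('a \<times> 'a) set \<Rightarrow> nat \<Rightarrow> 'a \<Rightarrow> 'a \<Rightarrow> nat set" where
  "visits U n x y = {i. i < n \<and> ((T ^^ i) x, (T ^^ i) y) \<in> U}"

text \<open>The quantifiers mirror the negation of sensitivity in the mean. Since the bound is not
  strict, \<open>n = 0\<close> may be included.\<close>

definition rarely_visited :: "('a \<times> 'a) set \<Rightarrow> bool" where
  "rarely_visited U \<longleftrightarrow>
     (\<forall>c>0. \<exists>\<delta>>0. \<forall>x\<in>X. \<forall>y\<in>X. d x y < \<delta> \<longrightarrow> (\<forall>n. real (card (visits U n x y)) \<le> c * real n))"

section \<open>Rarely visited sets form an ideal\<close>

lemma finite_visits [simp]: "finite (visits U n x y)"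
  by (simp add: visits_def)

lemma rarely_visited_mono: "rarely_visited V \<Longrightarrow> U \<subseteq> V \<Longrightarrow> rarely_visited U"
proof -
  assume V: "rarely_visited V" and "U \<subseteq> V"
  then have "card (visits U n x y) \<le> card (visits V n x y)" for n x y
    by (intro card_mono finite_visits) (auto simp: visits_def)
  then have "real (card (visits U n x y)) \<le> c" if "real (card (visits V n x y)) \<le> c" for n x y c
    using that by (meson of_nat_mono order_trans)
  then show ?thesis using V unfolding rarely_visited_def by meson
qed

lemma rarely_visited_Un:
  assumes "rarely_visited U" "rarely_visited V"
  shows "rarely_visited (U \<union> V)"
  unfolding rarely_visited_def
proof (intro allI impI)
  fix c :: real assume "0 < c"
  then have c: "0 < c / 2" by simp
  obtain \<delta> where \<delta>: "\<delta> > 0"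
    "\<forall>x\<in>X. \<forall>y\<in>X. d x y < \<delta> \<longrightarrow> (\<forall>n. real (card (visits U n x y)) \<le> c / 2 * real n)"
    using assms(1)[unfolded rarely_visited_def, rule_format, OF c] by blast
  obtain \<eta> where \<eta>: "\<eta> > 0"
    "\<forall>x\<in>X. \<forall>y\<in>X. d x y < \<eta> \<longrightarrow> (\<forall>n. real (card (visits V n x y)) \<le> c / 2 * real n)"
    using assms(2)[unfolded rarely_visited_def, rule_format, OF c] by blast
  show "\<exists>\<delta>>0. \<forall>x\<in>X. \<forall>y\<in>X. d x y < \<delta> \<longrightarrow>
      (\<forall>n. real (card (visits (U \<union> V) n x y)) \<le> c * real n)"
  proof (intro exI[of _ "min \<delta> \<eta>"] conjI ballI impI allI)
    show "0 < min \<delta> \<eta>" using \<delta> \<eta> by simp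
    fix x y n assume xy: "x \<in> X" "y \<in> X" "d x y < min \<delta> \<eta>"
    have "visits (U \<union> V) n x y = visits U n x y \<union> visits V n x y"
      by (auto simp: visits_def)
    then have "card (visits (U \<union> V) n x y) \<le> card (visits U n x y) + card (visits V n x y)"
      by (simp add: card_Un_le)
    moreover have "real (card (visits U n x y)) \<le> c / 2 * real n" using \<delta>(2) xy by simp
    moreover have "real (card (visits V n x y)) \<le> c / 2 * real n" using \<eta>(2) xy by simp
    ultimately show "real (card (visits (U \<union> V) n x y)) \<le> c * real n" by simp
  qed
qed

lemma rarely_visited_Union:
  assumes "finite \<F>" "\<And>U. U \<in> \<F> \<Longrightarrow> rarely_visited U"
  shows "rarely_visited (\<Union>\<F>)"
  using assms
proof (induction rule: finite_induct)
  case empty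
  then show ?case by (auto simp: rarely_visited_def visits_def intro: exI[of _ 1])
next
  case (insert U \<F>)
  then show ?case by (simp add: rarely_visited_Un)
qed

lemma not_sensitive_imp_rarely_visited:
  assumes "\<not> sensitive_in_mean X d T x y"
  shows "\<exists>\<tau>>0. rarely_visited (mball x \<tau> \<times> mball y \<tau>)"
proof -
  from assms obtain \<tau> where "\<tau> > 0" and \<tau>: "\<not> (\<exists>c>0. \<forall>\<epsilon>>0. \<exists>x'\<in>X. \<exists>y'\<in>X. \<exists>n\<ge>1::nat. d x' y' < \<epsilon> \<and>
        (1 / real n) * real (card {i. i < n \<and> d ((T ^^ i) x') x < \<tau> \<and> d ((T ^^ i) y') y < \<tau>}) > c)"
    unfolding sensitive_in_mean_def de_Morgan_disj not_all not_imp by (elim conjE exE)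
  have "rarely_visited (mball x \<tau> \<times> mball y \<tau>)"
    unfolding rarely_visited_def
  proof (intro allI impI)
    fix c :: real assume "0 < c"
    with \<tau> obtain \<epsilon> where "\<epsilon> > 0" and \<epsilon>: "\<not> (\<exists>x'\<in>X. \<exists>y'\<in>X. \<exists>n\<ge>1::nat. d x' y' < \<epsilon> \<and>
        (1 / real n) * real (card {i. i < n \<and> d ((T ^^ i) x') x < \<tau> \<and> d ((T ^^ i) y') y < \<tau>}) > c)"
      by blast
    show "\<exists>\<delta>>0. \<forall>x'\<in>X. \<forall>y'\<in>X. d x' y' < \<delta> \<longrightarrow>
        (\<forall>n. real (card (visits (mball x \<tau> \<times> mball y \<tau>) n x' y')) \<le> c * real n)"
    proof (intro exI[of _ \<epsilon>] conjI ballI impI allI)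
      fix x' y' n assume xy: "x' \<in> X" "y' \<in> X" "d x' y' < \<epsilon>"
      let ?I = "{i. i < n \<and> d ((T ^^ i) x') x < \<tau> \<and> d ((T ^^ i) y') y < \<tau>}"
      have "card (visits (mball x \<tau> \<times> mball y \<tau>) n x' y') \<le> card ?I"
        by (intro card_mono) (auto simp: visits_def commute)
      moreover have "real (card ?I) \<le> c * real n"
      \<comment> \<open>Sensitivity speaks of \<open>n \<ge> 1\<close> only; at \<open>n = 0\<close>
        both sides vanish.\<close>
      proof (cases "n = 0")
        case False
        then have "(1 / real n) * real (card ?I) \<le> c" using \<epsilon> xy by (meson not_le less_one)
        then show ?thesis using False by (simp add: field_simps)
      qed simp
      ultimately show "real (card (visits (mball x \<tau> \<times> mball y \<tau>) n x' y')) \<le> c * real n"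
        by linarith
    qed fact
  qed
  with \<open>\<tau> > 0\<close> show ?thesis by blast
qed

text \<open>By compactness of \<open>X \<times> X\<close> it suffices to find a suitable box about
  each pair. Where \<open>D\<close> vanishes, a small box misses the set; elsewhere the pair is not
  in \<open>Q_me X d T\<close> and has a rarely visited box.\<close>

lemma rarely_visited_observable_large:
  assumes Q: "\<And>x y. (x, y) \<in> Q_me X d T \<Longrightarrow> D x y = 0" and "0 < \<epsilon>"
  shows "rarely_visited {(x, y). \<epsilon> \<le> D x y}"
proof -
  let ?E = "{(x, y). \<epsilon> \<le> D x y}"
  have loc: "\<exists>\<tau>>0. rarely_visited ((mball x \<tau> \<times> mball y \<tau>) \<inter> ?E)" if "x \<in> X" "y \<in> X" for x y
  proof (cases "D x y = 0")
    case True
    obtain \<tau> where \<tau>: "\<tau> > 0" "\<forall>x\<in>X. \<forall>y\<in>X. d x y < \<tau> \<longrightarrow> D x y < \<epsilon> / 2"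
      using D_unif[of "\<epsilon> / 2"] \<open>0 < \<epsilon>\<close> by auto
    have "(mball x \<tau> \<times> mball y \<tau>) \<inter> ?E = {}"
    proof -
      { fix a b assume ab: "a \<in> mball x \<tau>" "b \<in> mball y \<tau>"
        then have "D x a < \<epsilon> / 2" "D y b < \<epsilon> / 2" using \<tau>(2) by auto
        moreover have "D a b \<le> D x a + D x y + D y b"
          using D_triangle[of a x b] D_triangle[of x y b] ab D_commute[of a x] by auto
        ultimately have "D a b < \<epsilon>" using True by simp }
      then show ?thesis by fastforce
    qed
    then show ?thesis using \<tau>(1) rarely_visited_Union[of "{}"] by auto
  next
    case False
    then have "\<not> sensitive_in_mean X d T x y" using Q that by (auto simp: Q_me_def)
    then show ?thesis using not_sensitive_imp_rarely_visited rarely_visited_mono by (meson inf_le1)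
  qed
  let ?P = "prod_topology mtopology mtopology"
  let ?\<U> = "{U. openin ?P U \<and> rarely_visited (U \<inter> ?E)}"
  have "compact_space ?P" using compact_X by (simp add: compact_space_prod_topology)
  moreover have "topspace ?P \<subseteq> \<Union>?\<U>"
  proof
    fix p assume "p \<in> topspace ?P"
    then obtain x y where p: "p = (x, y)" "x \<in> X" "y \<in> X" by auto
    then obtain \<tau> where "\<tau> > 0" "rarely_visited ((mball x \<tau> \<times> mball y \<tau>) \<inter> ?E)" using loc by blast
    then show "p \<in> \<Union>?\<U>"
      using p by (intro UnionI[of "mball x \<tau> \<times> mball y \<tau>"]) (auto simp: openin_prod_Times_iff)
  qed
  ultimately obtain \<F> where \<F>: "finite \<F>" "\<F> \<subseteq> ?\<U>" "topspace ?P \<subseteq> \<Union>\<F>"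
    unfolding compact_space_alt by (metis (no_types, lifting) mem_Collect_eq)
  have "rarely_visited (\<Union>((\<lambda>U. U \<inter> ?E) ` \<F>))"
    using \<F> by (intro rarely_visited_Union) auto
  moreover have "X \<times> X \<inter> ?E \<subseteq> \<Union>((\<lambda>U. U \<inter> ?E) ` \<F>)" using \<F>(3) by auto
  ultimately have "rarely_visited (X \<times> X \<inter> ?E)" by (rule rarely_visited_mono)
  \<comment> \<open>The cover controls only pairs in \<open>X \<times> X\<close>, but orbits never
    leave it.\<close>
  moreover have "visits (X \<times> X \<inter> ?E) n x y = visits ?E n x y" if "x \<in> X" "y \<in> X" for n x y
    using that funpow_closed by (auto simp: visits_def)
  ultimately show ?thesis unfolding rarely_visited_def by simp
qed

text \<open>Split the times by whether \<open>D\<close> reaches \<epsilon>: the small terms average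
  below \<epsilon>, and the large ones are rare and bounded by \<open>\<bar>K\<bar>\<close>.\<close>

lemma zero_on_Q_me_imp_equicontinuous_in_the_mean:
  assumes Q: "\<And>x y. (x, y) \<in> Q_me X d T \<Longrightarrow> D x y = 0"
  shows equicontinuous_in_the_mean
  unfolding equicontinuous_in_the_mean_def
proof (intro allI impI)
  fix \<epsilon>' :: real assume "0 < \<epsilon>'"
  define \<epsilon> where "\<epsilon> = \<epsilon>' / 3"
  \<comment> \<open>Chosen so that \<open>c * \<bar>K\<bar>\<close> is at most \<epsilon>; adding 1
    keeps the denominator positive.\<close>
  define c where "c = \<epsilon> / (\<bar>K\<bar> + 1)"
  have "0 < \<epsilon>" "0 < c" using \<open>0 < \<epsilon>'\<close> by (simp_all add: \<epsilon>_def c_def)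
  let ?E = "{(x, y). \<epsilon> \<le> D x y}"
  obtain \<delta> where \<delta>: "\<delta> > 0"
    "\<forall>x\<in>X. \<forall>y\<in>X. d x y < \<delta> \<longrightarrow> (\<forall>n. real (card (visits ?E n x y)) \<le> c * real n)"
    using rarely_visited_observable_large[OF Q \<open>0 < \<epsilon>\<close>] \<open>0 < c\<close> unfolding rarely_visited_def by blast
  show "\<exists>\<delta>>0. \<forall>x\<in>X. \<forall>y\<in>X. d x y < \<delta> \<longrightarrow> (\<forall>n\<ge>1. orbit_sum n x y < \<epsilon>' * real n)"
  proof (intro exI[of _ \<delta>] conjI ballI impI allI)
    fix x y :: 'a and n :: nat assume xy: "x \<in> X" "y \<in> X" "d x y < \<delta>" and n: "1 \<le> n"
    let ?V = "visits ?E n x y"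
    have "orbit_sum n x y \<le> (\<Sum>i<n. \<epsilon> + (if i \<in> ?V then \<bar>K\<bar> else 0))"
      unfolding orbit_sum_def
    proof (rule sum_mono)
      fix i assume "i \<in> {..<n}"
      then show "D ((T ^^ i) x) ((T ^^ i) y) \<le> \<epsilon> + (if i \<in> ?V then \<bar>K\<bar> else 0)"
        using D_bound[OF funpow_closed[of x i] funpow_closed[of y i]] xy \<open>0 < \<epsilon>\<close> by (auto simp: visits_def)
    qed
    also have "\<dots> = \<epsilon> * real n + (\<Sum>i<n. if i \<in> ?V then \<bar>K\<bar> else 0)"
      by (simp add: sum.distrib)
    also have "(\<Sum>i<n. if i \<in> ?V then \<bar>K\<bar> else 0) = (\<Sum>i\<in>{..<n} \<inter> ?V. \<bar>K\<bar>)"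
      by (subst sum.inter_restrict) simp_all
    also have "{..<n} \<inter> ?V = ?V" by (auto simp: visits_def)
    also have "(\<Sum>i\<in>?V. \<bar>K\<bar>) = real (card ?V) * \<bar>K\<bar>" by simp
    also have "real (card ?V) * \<bar>K\<bar> \<le> (c * real n) * \<bar>K\<bar>" using \<delta>(2) xy by (intro mult_right_mono) auto
    also have "(c * real n) * \<bar>K\<bar> \<le> \<epsilon> * real n"
    proof -
      have "c * \<bar>K\<bar> \<le> \<epsilon>" using \<open>0 < \<epsilon>\<close> by (simp add: c_def field_simps)
      then show ?thesis using mult_right_mono[of "c * \<bar>K\<bar>" \<epsilon> "real n"] by (simp add: mult_ac)
    qed
    also have "\<epsilon> * real n + \<epsilon> * real n < \<epsilon>' * real n" using \<open>0 < \<epsilon>'\<close> n by (simp add: \<epsilon>_def)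
    finally show "orbit_sum n x y < \<epsilon>' * real n" by simp
  qed (fact \<delta>)
qed

text \<open>Pairs along which \<open>D\<close> tends to 0 have a cluster point, on which
  \<open>D\<close> vanishes by continuity, and infinitely many of them are \<open>d\<close>-close to
  it.\<close>

lemma near_zero_set:
  assumes "0 < \<delta>"
  shows "\<exists>\<eta>>0. \<forall>x\<in>X. \<forall>y\<in>X. D x y < \<eta> \<longrightarrow> (\<exists>x'\<in>X. \<exists>y'\<in>X. D x' y' = 0 \<and> d x x' < \<delta> \<and> d y y' < \<delta>)"
proof (rule ccontr)
  assume "\<not> ?thesis"
  then have "\<forall>n::nat. \<exists>x\<in>X. \<exists>y\<in>X. D x y < 1 / real (Suc n) \<and>
      \<not> (\<exists>x'\<in>X. \<exists>y'\<in>X. D x' y' = 0 \<and> d x x' < \<delta> \<and> d y y' < \<delta>)"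
    by (metis of_nat_0_less_iff zero_less_Suc zero_less_divide_1_iff)
  then obtain u v where uv: "\<And>n. u n \<in> X" "\<And>n. v n \<in> X" "\<And>n::nat. D (u n) (v n) < 1 / real (Suc n)"
    "\<And>n x' y'. \<lbrakk>x' \<in> X; y' \<in> X; D x' y' = 0; d (u n) x' < \<delta>\<rbrakk> \<Longrightarrow> \<not> d (v n) y' < \<delta>"
    by metis
  obtain x y where xy: "x \<in> X" "y \<in> X"
    "\<And>\<epsilon> N. 0 < \<epsilon> \<Longrightarrow> \<exists>n\<ge>N. d (u n) x < \<epsilon> \<and> d (v n) y < \<epsilon>"
    using pair_subsequence[of u v] uv by metis
  have "D x y \<le> \<epsilon>" if "0 < \<epsilon>" for \<epsilon>
  proof -
    obtain \<eta> where \<eta>: "\<eta> > 0" "\<forall>x\<in>X. \<forall>y\<in>X. d x y < \<eta> \<longrightarrow> D x y < \<epsilon> / 3"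
      using D_unif[of "\<epsilon> / 3"] \<open>0 < \<epsilon>\<close> by auto
    obtain N where N: "1 / real (Suc N) < \<epsilon> / 3" using nat_approx_posE[of "\<epsilon> / 3"] \<open>0 < \<epsilon>\<close> by auto
    obtain n where n: "n \<ge> N" "d (u n) x < \<eta>" "d (v n) y < \<eta>" using xy(3)[OF \<eta>(1)] by blast
    have "1 / real (Suc n) \<le> 1 / real (Suc N)" using n(1) by (simp add: field_simps)
    then have "D (u n) (v n) < \<epsilon> / 3" using uv(3)[of n] N by linarith
    moreover have "D (u n) x < \<epsilon> / 3" "D (v n) y < \<epsilon> / 3" using \<eta>(2) n uv xy by auto
    moreover have "D x y \<le> D x (u n) + (D (u n) (v n) + D (v n) y)"
      using D_triangle[of x "u n" y] D_triangle[of "u n" "v n" y] uv xy by force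
    ultimately show ?thesis using D_commute[of x "u n"] by simp
  qed
  then have "D x y = 0" using D_nonneg[of x y] by (metis dense_ge order_antisym)
  moreover obtain n where "d (u n) x < \<delta>" "d (v n) y < \<delta>" using xy(3)[OF assms, of 0] by blast
  ultimately show False using uv(4) xy by blast
qed

text \<open>Pairs close for \<open>D\<close> need not be close for \<open>d\<close>; they are compared through a \<open>d\<close>-close pair
  on which \<open>D\<close> vanishes, and \<open>D\<close> vanishes along the orbit of such a pair.\<close>

lemma equicontinuous_in_the_mean_observable:
  assumes equicontinuous_in_the_mean
    and inv: "\<And>x y. \<lbrakk>x \<in> X; y \<in> X; D x y = 0\<rbrakk> \<Longrightarrow> D (T x) (T y) = 0" and "0 < \<epsilon>"
  shows "\<exists>\<delta>>0. \<forall>x\<in>X. \<forall>y\<in>X. D x y < \<delta> \<longrightarrow> (\<forall>n\<ge>1. orbit_sum n x y < \<epsilon> * real n)"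
proof -
  obtain \<delta> where \<delta>: "\<delta> > 0" "\<forall>x\<in>X. \<forall>y\<in>X. d x y < \<delta> \<longrightarrow> (\<forall>n\<ge>1. orbit_sum n x y < \<epsilon> / 2 * real n)"
    using assms(1)[unfolded equicontinuous_in_the_mean_def, rule_format, of "\<epsilon> / 2"] \<open>0 < \<epsilon>\<close> by auto
  obtain \<eta> where \<eta>: "\<eta> > 0" "\<forall>x\<in>X. \<forall>y\<in>X. D x y < \<eta> \<longrightarrow>
      (\<exists>x'\<in>X. \<exists>y'\<in>X. D x' y' = 0 \<and> d x x' < \<delta> \<and> d y y' < \<delta>)"
    using near_zero_set[OF \<delta>(1)] by blast
  show ?thesis
  proof (intro exI[of _ \<eta>] conjI ballI impI allI)
    fix x y :: 'a and n :: nat assume xy: "x \<in> X" "y \<in> X" "D x y < \<eta>" and n: "1 \<le> n"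
    then obtain x' y' where x': "x' \<in> X" "y' \<in> X" "D x' y' = 0" "d x x' < \<delta>" "d y y' < \<delta>"
      using \<eta>(2) by blast
    have "D ((T ^^ i) x') ((T ^^ i) y') = 0" for i
      by (induction i) (use x' inv funpow_closed in auto)
    then have "orbit_sum n x' y' = 0" by (simp add: orbit_sum_def)
    moreover have "orbit_sum n x x' < \<epsilon> / 2 * real n" "orbit_sum n y y' < \<epsilon> / 2 * real n"
      using \<delta>(2) xy x' n by auto
    moreover have "orbit_sum n x y \<le> orbit_sum n x x' + (orbit_sum n x' y' + orbit_sum n y' y)"
      using orbit_sum_triangle[of x x' y n] orbit_sum_triangle[of x' y' y n] xy x' by force
    ultimately show "orbit_sum n x y < \<epsilon> * real n"
      using orbit_sum_commute[of n y' y] by simp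
  qed (fact \<eta>)
qed

end

section \<open>Mean equicontinuous quotients\<close>

text \<open>Heine-Cantor, in the form of the assumptions of \<open>observed_system\<close>.\<close>

lemma (in Metric_space) compact_continuous_imp_uniform:
  assumes "compact_space mtopology" "Metric_space N e"
    and "continuous_map mtopology (Metric_space.mtopology N e) f" and "0 < \<epsilon>"
  shows "\<exists>\<delta>>0. \<forall>x\<in>M. \<forall>y\<in>M. d x y < \<delta> \<longrightarrow> e (f x) (f y) < \<epsilon>"
proof -
  interpret N: Metric_space N e by fact
  have "uniformly_continuous_map (metric (M, d)) (metric (N, e)) f"
    using assms by (intro continuous_imp_uniformly_continuous_map)
      (simp add: mtopology_of_def mspace_metric mdist_metric N.mspace_metric N.mdist_metric)
  then show ?thesis
    using \<open>0 < \<epsilon>\<close> by (simp add: uniformly_continuous_map_def) (metis commute N.commute)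
qed

text \<open>Invariance puts the \<open>T\<close>-image of a class inside a single class, and the
  outer image under \<open>R\<close> fills that class up.\<close>

lemma quotient_dyn_funpow:
  assumes "equiv X R" "\<And>x y. (x, y) \<in> R \<Longrightarrow> (T x, T y) \<in> R" "x \<in> X" "\<And>x. x \<in> X \<Longrightarrow> T x \<in> X"
  shows "(quotient_dyn T R ^^ i) (R `` {x}) = R `` {(T ^^ i) x}"
proof (induction i)
  case (Suc i)
  have "(T ^^ i) x \<in> X" for i by (induction i) (use assms in auto)
  then have "((T ^^ i) x, (T ^^ i) x) \<in> R" using assms(1) by (meson equivE refl_onD)
  moreover have "R `` (T ` (R `` {z})) = R `` {T z}" if "(z, z) \<in> R" for z
  proof
    show "R `` (T ` (R `` {z})) \<subseteq> R `` {T z}"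
    proof
      fix w assume "w \<in> R `` (T ` (R `` {z}))"
      then obtain u where "(z, u) \<in> R" "(T u, w) \<in> R" by blast
      moreover from this assms(2) have "(T z, T u) \<in> R" by blast
      ultimately show "w \<in> R `` {T z}" using assms(1) by (meson Image_singleton_iff equivE transD)
    qed
    show "R `` {T z} \<subseteq> R `` (T ` (R `` {z}))" using that by blast
  qed
  ultimately show ?case using Suc.IH by (simp add: quotient_dyn_def)
qed simp

text \<open>The pullback \<open>D\<close> of \<open>d'\<close> vanishes exactly on \<open>R\<close>,
  so the results on \<open>observed_system\<close> apply. The right-hand side does not mention
  \<open>d'\<close>, hence the choice of compatible metric is immaterial.\<close>

lemma mean_equicontinuous_quotient_metric_iff:
  assumes dyn: "dynamical_system X d T" and R: "closed_invariant_equiv X d T R"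
    and d': "Metric_space (X // R) d'"
    and qm: "quotient_map (Metric_space.mtopology X d) (Metric_space.mtopology (X // R) d') (\<lambda>x. R `` {x})"
  shows "mean_equicontinuous (X // R) d' (quotient_dyn T R) \<longleftrightarrow> Q_me X d T \<subseteq> R"
proof -
  interpret Metric_space X d using dyn by (simp add: dynamical_system_def)
  interpret Y: Metric_space "X // R" d' by (fact d')
  have comp: "compact_space mtopology" and cT: "continuous_map mtopology mtopology T"
    using dyn by (simp_all add: dynamical_system_def)
  have eqv: "equiv X R" and inv: "\<And>x y. (x, y) \<in> R \<Longrightarrow> (T x, T y) \<in> R"
    using R by (auto simp: closed_invariant_equiv_def)
  have TX: "T x \<in> X" if "x \<in> X" for x
    using continuous_map_image_subset_topspace[OF cT] that by auto
  have piX: "R `` {x} \<in> X // R" if "x \<in> X" for x using that by (rule quotientI)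
  have cpi: "continuous_map mtopology Y.mtopology (\<lambda>x. R `` {x})"
    using qm by (rule quotient_imp_continuous_map)
  \<comment> \<open>The quotient is compact, which supplies the bound \<open>K\<close> on
    \<open>d'\<close>.\<close>
  have "compactin Y.mtopology ((\<lambda>x. R `` {x}) ` X)"
    using image_compactin[OF _ cpi] comp by (simp add: compact_space_def)
  then obtain K where K: "\<And>P Q. P \<in> (\<lambda>x. R `` {x}) ` X \<Longrightarrow> Q \<in> (\<lambda>x. R `` {x}) ` X \<Longrightarrow> d' P Q \<le> K"
    using Y.compactin_imp_mbounded Y.mbounded_alt by meson
  define D where "D x y = d' (R `` {x}) (R `` {y})" for x y
  interpret observed_system X d T D K
  proof
    show "compact_space mtopology" by (fact comp)
    show "\<exists>\<delta>>0. \<forall>x\<in>X. \<forall>y\<in>X. d x y < \<delta> \<longrightarrow> d (T x) (T y) < \<epsilon>" if "0 < \<epsilon>" for \<epsilon>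
      by (rule compact_continuous_imp_uniform[OF comp Metric_space_axioms cT that])
    show "\<exists>\<delta>>0. \<forall>x\<in>X. \<forall>y\<in>X. d x y < \<delta> \<longrightarrow> D x y < \<epsilon>" if "0 < \<epsilon>" for \<epsilon>
      unfolding D_def by (rule compact_continuous_imp_uniform[OF comp d' cpi that])
    show "D x y = D y x" for x y by (simp add: D_def Y.commute)
  qed (simp_all add: D_def TX piX Y.triangle K)
  have D0: "D x y = 0 \<longleftrightarrow> (x, y) \<in> R" if "x \<in> X" "y \<in> X" for x y
    unfolding D_def using that piX eq_equiv_class_iff[OF eqv] by simp
  have sum: "(\<Sum>i<n. d' ((quotient_dyn T R ^^ i) (R `` {x})) ((quotient_dyn T R ^^ i) (R `` {y})))
      = orbit_sum n x y" if "x \<in> X" "y \<in> X" for n x y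
    using that by (simp add: orbit_sum_def D_def quotient_dyn_funpow[OF eqv inv _ TX])
  show ?thesis
  proof
    assume me: "mean_equicontinuous (X // R) d' (quotient_dyn T R)"
    have "\<exists>\<delta>>0. \<forall>x\<in>X. \<forall>y\<in>X. d x y < \<delta> \<longrightarrow> mean_close \<epsilon> x y" if "0 < \<epsilon>" for \<epsilon>
    proof -
      obtain \<eta> where \<eta>: "\<eta> > 0" "\<forall>P\<in>X // R. \<forall>Q\<in>X // R. d' P Q < \<eta> \<longrightarrow>
          limsup (\<lambda>n. ereal ((1 / real n) * (\<Sum>i<n. d' ((quotient_dyn T R ^^ i) P) ((quotient_dyn T R ^^ i) Q)))) < ereal \<epsilon>"
        using me[unfolded mean_equicontinuous_def, rule_format, OF \<open>0 < \<epsilon>\<close>] by blast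
      obtain \<delta> where \<delta>: "\<delta> > 0" "\<forall>x\<in>X. \<forall>y\<in>X. d x y < \<delta> \<longrightarrow> D x y < \<eta>"
        using D_unif[OF \<eta>(1)] by blast
      have "mean_close \<epsilon> x y" if xy: "x \<in> X" "y \<in> X" "d x y < \<delta>" for x y
      proof -
        have "limsup (\<lambda>n. ereal ((1 / real n) * orbit_sum n x y)) < ereal \<epsilon>"
          using \<eta>(2)[rule_format, of "R `` {x}" "R `` {y}"] \<delta>(2) xy piX sum unfolding D_def by simp
        then have "\<forall>\<^sub>F n in sequentially. ereal ((1 / real n) * orbit_sum n x y) < ereal \<epsilon>"
          by (rule Limsup_lessD)
        then show ?thesis
          unfolding mean_close_def using eventually_gt_at_top[of 0]
          by eventually_elim (simp add: field_simps)
      qed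
      then show ?thesis using \<delta>(1) by blast
    qed
    then have equi: equicontinuous_in_the_mean by (rule mean_close_imp_equicontinuous_in_the_mean)
    show "Q_me X d T \<subseteq> R"
    proof clarify
      fix x y assume xy: "(x, y) \<in> Q_me X d T"
      then have "x \<in> X" "y \<in> X" by (auto simp: Q_me_def)
      with equicontinuous_in_the_mean_imp_zero_on_Q_me[OF equi xy] D0 show "(x, y) \<in> R" by simp
    qed
  next
    assume Q: "Q_me X d T \<subseteq> R"
    have "D x y = 0" if "(x, y) \<in> Q_me X d T" for x y
      using that Q D0[of x y] by (auto simp: Q_me_def)
    then have equi: equicontinuous_in_the_mean by (rule zero_on_Q_me_imp_equicontinuous_in_the_mean)
    have inv0: "D (T x) (T y) = 0" if "x \<in> X" "y \<in> X" "D x y = 0" for x y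
      using that D0 TX inv by simp
    show "mean_equicontinuous (X // R) d' (quotient_dyn T R)"
      unfolding mean_equicontinuous_def
    proof (intro allI impI)
      fix \<epsilon> :: real assume "0 < \<epsilon>"
      \<comment> \<open>Passing to the limsup only gives a weak inequality, hence the half.
        Closeness in the quotient is \<open>D\<close>-closeness, so equicontinuity in terms of
        \<open>d\<close> has to be converted first.\<close>
      then have "0 < \<epsilon> / 2" by simp
      then obtain \<delta> where \<delta>: "\<delta> > 0" "\<forall>x\<in>X. \<forall>y\<in>X. D x y < \<delta> \<longrightarrow> (\<forall>n\<ge>1. orbit_sum n x y < \<epsilon> / 2 * real n)"
        using equicontinuous_in_the_mean_observable[OF equi inv0] by blast
      show "\<exists>\<delta>>0. \<forall>P\<in>X // R. \<forall>Q\<in>X // R. d' P Q < \<delta> \<longrightarrow>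
          limsup (\<lambda>n. ereal ((1 / real n) * (\<Sum>i<n. d' ((quotient_dyn T R ^^ i) P) ((quotient_dyn T R ^^ i) Q)))) < ereal \<epsilon>"
      proof (intro exI[of _ \<delta>] conjI ballI impI)
        fix P Q assume "P \<in> X // R" "Q \<in> X // R" and PQ: "d' P Q < \<delta>"
        then obtain x y where xy: "x \<in> X" "P = R `` {x}" "y \<in> X" "Q = R `` {y}"
          by (meson quotientE)
        have "orbit_sum n x y < \<epsilon> / 2 * real n" if "n \<ge> 1" for n
          using \<delta>(2) xy PQ that by (simp add: D_def)
        then have "ereal ((1 / real n) * orbit_sum n x y) \<le> ereal (\<epsilon> / 2)" if "n \<ge> 1" for n
          using that by (simp add: pos_divide_le_eq less_imp_le)
        then have "\<forall>\<^sub>F n in sequentially. ereal ((1 / real n) * orbit_sum n x y) \<le> ereal (\<epsilon> / 2)"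
          by (rule eventually_sequentiallyI)
        then have "limsup (\<lambda>n. ereal ((1 / real n) * orbit_sum n x y)) \<le> ereal (\<epsilon> / 2)"
          by (rule Limsup_bounded)
        also have "\<dots> < ereal \<epsilon>" using \<open>0 < \<epsilon>\<close> by simp
        finally show "limsup (\<lambda>n. ereal ((1 / real n) * (\<Sum>i<n. d' ((quotient_dyn T R ^^ i) P) ((quotient_dyn T R ^^ i) Q)))) < ereal \<epsilon>"
          using xy sum by simp
      qed (fact \<delta>)
    qed
  qed
qed

text \<open>From left to right the given metric serves; conversely, metrizability of the quotient
  topology provides one.\<close>

lemma mean_equicontinuous_quotient_iff:
  assumes dyn: "dynamical_system X d T" and R: "closed_invariant_equiv X d T R"
  shows "mean_equicontinuous_quotient X d T R \<longleftrightarrow> Q_me X d T \<subseteq> R"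
proof
  assume "mean_equicontinuous_quotient X d T R"
  then obtain d' where "Metric_space (X // R) d'"
    "quotient_map (Metric_space.mtopology X d) (Metric_space.mtopology (X // R) d') (\<lambda>x. R `` {x})"
    "mean_equicontinuous (X // R) d' (quotient_dyn T R)"
    by (auto simp: mean_equicontinuous_quotient_def)
  then show "Q_me X d T \<subseteq> R"
    using mean_equicontinuous_quotient_metric_iff[OF assms] by blast
next
  assume Q: "Q_me X d T \<subseteq> R"
  interpret Metric_space X d using dyn by (simp add: dynamical_system_def)
  have "metrizable_space (quotient_space mtopology R)"
    using assms by (intro metrizable_space_quotient_space)
      (auto simp: dynamical_system_def closed_invariant_equiv_def)
  then obtain Y d' where "Metric_space Y d'" and Y: "quotient_space mtopology R = Metric_space.mtopology Y d'"
    by (auto simp: metrizable_space_def)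
  \<comment> \<open>Metrizability yields a metric on some carrier; comparing underlying spaces
    identifies it with the set of classes.\<close>
  moreover have "Y = X // R"
    using arg_cong[OF Y, of topspace] Metric_space.topspace_mtopology[OF \<open>Metric_space Y d'\<close>] by simp
  ultimately have d': "Metric_space (X // R) d'"
    and qm: "quotient_map mtopology (Metric_space.mtopology (X // R) d') (\<lambda>x. R `` {x})"
    using quotient_map_quotient_space[of mtopology R] by simp_all
  then show "mean_equicontinuous_quotient X d T R"
    unfolding mean_equicontinuous_quotient_def
    using mean_equicontinuous_quotient_metric_iff[OF assms d' qm] Q by blast
qed

text \<open>Nonemptiness keeps the intersection inside \<open>X \<times> X\<close>.\<close>

lemma closed_invariant_equiv_Inter:
  assumes "\<R> \<noteq> {}" "\<And>R. R \<in> \<R> \<Longrightarrow> closed_invariant_equiv X d T R"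
  shows "closed_invariant_equiv X d T (\<Inter>\<R>)"
  unfolding closed_invariant_equiv_def
proof (intro conjI allI impI)
  have R: "equiv X R" "closedin (prod_topology (Metric_space.mtopology X d) (Metric_space.mtopology X d)) R"
    "\<And>x y. (x, y) \<in> R \<Longrightarrow> (T x, T y) \<in> R" if "R \<in> \<R>" for R
    using assms(2)[OF that] unfolding closed_invariant_equiv_def by blast+
  show "equiv X (\<Inter>\<R>)"
  proof (rule equivI)
    obtain R where "R \<in> \<R>" using assms(1) by blast
    then show "\<Inter>\<R> \<subseteq> X \<times> X" using R(1) unfolding equiv_def by blast
    show "refl_on X (\<Inter>\<R>)" using R(1) unfolding equiv_def refl_on_def by blast
    show "sym (\<Inter>\<R>)" using R(1) unfolding equiv_def sym_def by blast
    show "trans (\<Inter>\<R>)"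
    proof (rule transI)
      fix x y z assume "(x, y) \<in> \<Inter>\<R>" "(y, z) \<in> \<Inter>\<R>"
      then have "(x, z) \<in> R" if "R \<in> \<R>" for R
        using R(1)[OF that] that by (meson InterD equivE transD)
      then show "(x, z) \<in> \<Inter>\<R>" by blast
    qed
  qed
  show "closedin (prod_topology (Metric_space.mtopology X d) (Metric_space.mtopology X d)) (\<Inter>\<R>)"
    using assms(1) R(2) by (rule closedin_Inter)
  show "(T x, T y) \<in> \<Inter>\<R>" if "(x, y) \<in> \<Inter>\<R>" for x y
    using that R(3) by blast
qed

text \<open>Ensures that the family intersected to obtain \<open>S_me X d T\<close> is
  nonempty.\<close>

lemma closed_invariant_equiv_full:
  assumes "dynamical_system X d T"
  shows "closed_invariant_equiv X d T (X \<times> X)"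
proof -
  interpret Metric_space X d using assms by (simp add: dynamical_system_def)
  have "equiv X (X \<times> X)"
    unfolding equiv_def refl_on_def sym_def trans_def by blast
  moreover have "T x \<in> X" if "x \<in> X" for x
    using assms continuous_map_image_subset_topspace[of mtopology mtopology T] that
    by (auto simp: dynamical_system_def)
  ultimately show ?thesis
    by (auto simp: closed_invariant_equiv_def closedin_prod_Times_iff)
qed

theorem theorem6p6:
  fixes X :: "'a set" and d :: "'a \<Rightarrow> 'a \<Rightarrow> real" and T :: "'a \<Rightarrow> 'a"
  assumes "dynamical_system X d T"
  shows "closed_invariant_equiv X d T (S_me X d T) \<and>
    Q_me X d T \<subseteq> S_me X d T \<and>
    (\<forall>R. closed_invariant_equiv X d T R \<and> Q_me X d T \<subseteq> R \<longrightarrow> S_me X d T \<subseteq> R)"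
proof -
  let ?\<R> = "{R. closed_invariant_equiv X d T R \<and> Q_me X d T \<subseteq> R}"
  have "X \<times> X \<in> ?\<R>"
    using closed_invariant_equiv_full[OF assms] by (auto simp: Q_me_def)
  then have "closed_invariant_equiv X d T (\<Inter>?\<R>)"
    by (intro closed_invariant_equiv_Inter) blast+
  then have Inter: "\<Inter>?\<R> \<in> ?\<R>" by blast
  \<comment> \<open>The predicate minimised in \<open>S_me\<close> is membership in
    \<open>?\<R>\<close>. As \<open>?\<R>\<close> contains its own intersection, that intersection
    is the least element for inclusion.\<close>
  have "(\<lambda>R. closed_invariant_equiv X d T R \<and> mean_equicontinuous_quotient X d T R) = (\<lambda>R. R \<in> ?\<R>)"
    using mean_equicontinuous_quotient_iff[OF assms] by (auto simp: fun_eq_iff)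
  then have "S_me X d T = (LEAST R. R \<in> ?\<R>)"
    by (simp only: S_me_def)
  also have "\<dots> = \<Inter>?\<R>"
    using Inter by (intro Least_equality) (assumption, blast)
  finally have "S_me X d T = \<Inter>?\<R>" .
  with Inter show ?thesis by auto
qed

end
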